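(* Let $(N,\mathcal{A},u)$ be an incave potential game with potential function $P$. Then the game has a Nash equilibrium and the set of Nash equilibria is connected.
   Context: An $n$-player game is a tuple $(N,\mathcal{A},u)$ with players $N=\{1,\dots,n\}$, joint action space $\mathcal{A}=\prod_{i=1}^n A_i$ with $A_i=\mathbb{R}^{n_i}$, $n_i\in\mathbb{N}$, and utilities $u=(u_1,\dots,u_n)$, $u_i:\mathcal{A}\to\mathbb{R}$. Write $a_{-i}$ for the actions of all players except $i$, and $\mathrm{BR}_i(a_{-i})=\arg\max_{a_i\in A_i}u_i(a_i,a_{-i})$. An action profile $a\in\mathcal{A}$ is a Nash equilibrium if $a_i\in\mathrm{BR}_i(a_{-i})$ for all $i\in N$. A differentiable function $g:\mathbb{R}^m\to\mathbb{R}$ is invex if every stationary point is a global minimum; it is incave if $-g$ is invex. $g$ is decreasing at infinity if for every $x$ there is a compact set $K$ with $g(z)<g(x)$ for all $z\notin K$. The game is an incave potential game if the $u_i$ are continuously differentiable and there exists a function $P:\mathcal{A}\to\mathbb{R}$ (a potential function) with $\frac{\partial P(a)}{\partial a_i}=\frac{\partial u_i(a)}{\partial a_i}$ for all $i\in N$, $a\in\mathcal{A}$, such that $P$ is continuously differentiable, incave, and decreasing at infinity. *)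

theory Defs
  imports "HOL-Analysis.Analysis"
begin

text \<open>
  Players form a finite type \<open>'n\<close>. The joint action space, the product of the spaces
  \<open>A\<^sub>i = \<real>\<^bsup>n\<^sub>i\<^esup>\<close>, is \<open>real ^ 'k\<close>, where \<open>owner :: 'k \<Rightarrow> 'n\<close> says which player controls
  each coordinate; so \<open>n\<^sub>i = card {k. owner k = i}\<close>, and every choice of numbers \<open>n\<^sub>i\<close>, not all
  of them zero, arises in this way. The space \<open>A\<^sub>i\<close> is identified with the coordinate subspace of
  vectors that vanish outside the coordinates of player \<open>i\<close>.
\<close>

definition actions :: "('k::finite \<Rightarrow> 'n::finite) \<Rightarrow> 'n \<Rightarrow> (real ^ 'k) set" where
  "actions owner i = {x. \<forall>k. owner k \<noteq> i \<longrightarrow> x $ k = 0}"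

definition action_of :: "('k::finite \<Rightarrow> 'n::finite) \<Rightarrow> 'n \<Rightarrow> real ^ 'k \<Rightarrow> real ^ 'k" where
  "action_of owner i a = (\<chi> k. if owner k = i then a $ k else 0)"

text \<open>
  The profile \<open>(x\<^sub>i, a\<^sub>-\<^sub>i)\<close>. It depends on \<open>x\<close> only through the coordinates of player \<open>i\<close>
  and on \<open>a\<close> only through the coordinates of the other players.
\<close>

definition deviate ::
  "('k::finite \<Rightarrow> 'n::finite) \<Rightarrow> 'n \<Rightarrow> real ^ 'k \<Rightarrow> real ^ 'k \<Rightarrow> real ^ 'k" where
  "deviate owner i x a = (\<chi> k. if owner k = i then x $ k else a $ k)"

definition best_response ::
  "('k::finite \<Rightarrow> 'n::finite) \<Rightarrow> ('n \<Rightarrow> real ^ 'k \<Rightarrow> real) \<Rightarrow> 'n \<Rightarrow> real ^ 'k \<Rightarrow> (real ^ 'k) set" where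
  "best_response owner u i a =
     {x. is_arg_max (\<lambda>y. u i (deviate owner i y a)) (\<lambda>y. y \<in> actions owner i) x}"

definition nash_equilibrium ::
  "('k::finite \<Rightarrow> 'n::finite) \<Rightarrow> ('n \<Rightarrow> real ^ 'k \<Rightarrow> real) \<Rightarrow> real ^ 'k \<Rightarrow> bool" where
  "nash_equilibrium owner u a \<longleftrightarrow> (\<forall>i. action_of owner i a \<in> best_response owner u i a)"

definition continuously_differentiable :: "('a::euclidean_space \<Rightarrow> real) \<Rightarrow> bool" where
  "continuously_differentiable g \<longleftrightarrow>
     (\<exists>g'. (\<forall>x. (g has_derivative blinfun_apply (g' x)) (at x)) \<and> continuous_on UNIV g')"

definition invex :: "('a::euclidean_space \<Rightarrow> real) \<Rightarrow> bool" where
  "invex g \<longleftrightarrow>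
     (\<forall>x. g differentiable (at x)) \<and>
     (\<forall>x. (g has_derivative (\<lambda>h. 0)) (at x) \<longrightarrow> (\<forall>y. g x \<le> g y))"

definition incave :: "('a::euclidean_space \<Rightarrow> real) \<Rightarrow> bool" where
  "incave g \<longleftrightarrow> invex (\<lambda>x. - g x)"

definition decreasing_at_infinity :: "('a::euclidean_space \<Rightarrow> real) \<Rightarrow> bool" where
  "decreasing_at_infinity g \<longleftrightarrow> (\<forall>x. \<exists>K. compact K \<and> (\<forall>z. z \<notin> K \<longrightarrow> g z < g x))"

text \<open>
  The partial derivative of \<open>f\<close> with respect to the whole action \<open>a\<^sub>i\<close>, at the profile \<open>a\<close>. As a
  linear form on \<open>real ^ 'k\<close> it vanishes on the coordinates of the other players. It is only
  meaningful where the derivative exists.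
\<close>

definition partial_derivative ::
  "('k::finite \<Rightarrow> 'n::finite) \<Rightarrow> 'n \<Rightarrow> (real ^ 'k \<Rightarrow> real) \<Rightarrow> real ^ 'k \<Rightarrow> real ^ 'k \<Rightarrow> real" where
  "partial_derivative owner i f a = frechet_derivative (\<lambda>x. f (deviate owner i x a)) (at a)"

definition incave_potential_game ::
  "('k::finite \<Rightarrow> 'n::finite) \<Rightarrow> ('n \<Rightarrow> real ^ 'k \<Rightarrow> real) \<Rightarrow> (real ^ 'k \<Rightarrow> real) \<Rightarrow> bool" where
  "incave_potential_game owner u P \<longleftrightarrow>
     (\<forall>i. continuously_differentiable (u i)) \<and>
     (\<forall>i a. partial_derivative owner i P a = partial_derivative owner i (u i) a) \<and>
     continuously_differentiable P \<and> incave P \<and> decreasing_at_infinity P"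

end

theory Submission
  imports Defs
begin

text \<open>
  Along the actions of one player, the utility and \<open>P\<close> differ by a constant. So at an equilibrium all
  partial derivatives of \<open>P\<close> vanish, and by incavity the equilibria are exactly the minimisers of
  \<open>f = - P\<close>, which exist because the sublevel sets of \<open>f\<close> are compact. No mountain pass theorem and
  no gradient flow is needed for connectedness: since \<open>f\<close> has no critical points above its minimum,
  for \<open>c > min f\<close> and a small step size \<open>t\<close> the continuous map \<open>x \<mapsto> x - t \<nabla>f(x)\<close> fixes every
  minimiser, and its iterates push a large ball below the level \<open>c\<close>. The image of the ball is a
  connected set that contains all minimisers and lies in \<open>{f \<le> c}\<close>. If the set of minimisers
  were disconnected, then so would be, for \<open>c\<close> close to \<open>min f\<close>, every such set.
\<close>

section \<open>Gradients and the descent estimate\<close>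

lemma continuously_differentiable_gradient:
  fixes f :: "'a::euclidean_space \<Rightarrow> real"
  assumes "continuously_differentiable f"
  obtains g where "\<And>x. (f has_derivative (\<lambda>h. g x \<bullet> h)) (at x)" "continuous_on UNIV g"
proof -
  obtain f' where d: "\<And>x. (f has_derivative blinfun_apply (f' x)) (at x)"
    and c: "continuous_on UNIV f'"
    using assms unfolding continuously_differentiable_def by blast
  define g where "g x = (\<Sum>b\<in>Basis. blinfun_apply (f' x) b *\<^sub>R b)" for x
  have "blinfun_apply (f' x) h = g x \<bullet> h" for x h
  proof -
    have "blinfun_apply (f' x) h = blinfun_apply (f' x) (\<Sum>b\<in>Basis. (h \<bullet> b) *\<^sub>R b)"
      by (simp add: euclidean_representation)
    also have "\<dots> = g x \<bullet> h"
      by (simp add: g_def blinfun.sum_right blinfun.scaleR_right inner_sum_left inner_commute[of h]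
          mult.commute)
    finally show ?thesis .
  qed
  then have "(f has_derivative (\<lambda>h. g x \<bullet> h)) (at x)" for x
    using d[of x] by presburger
  moreover have "continuous_on UNIV g"
    unfolding g_def by (intro continuous_intros c)
  ultimately show thesis by (rule that)
qed

text \<open>By the mean value theorem the change of \<open>f\<close> along the step is governed by
  the gradient at an intermediate point, which uniform continuity keeps within
  \<open>\<epsilon>\<close> of \<open>g x\<close>. Where \<open>norm (g x) < \<epsilon>\<close> the
  bound permits an increase, but a controlled one; both regimes matter later.\<close>

lemma gradient_step_estimate:
  fixes f :: "'a::euclidean_space \<Rightarrow> real"
  assumes deriv: "\<And>x. (f has_derivative (\<lambda>h. g x \<bullet> h)) (at x)"
    and cont: "continuous_on UNIV g"
    and L: "compact L" and "\<epsilon> > 0"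
  obtains s where "s > 0"
    "\<And>x t. x \<in> L \<Longrightarrow> 0 < t \<Longrightarrow> t \<le> s \<Longrightarrow>
       f (x - t *\<^sub>R g x) \<le> f x - t * norm (g x) * (norm (g x) - \<epsilon>)"
proof -
  obtain R where R: "R > 0" "\<And>x. x \<in> L \<Longrightarrow> norm x \<le> R"
    using compact_imp_bounded[OF L] by (meson bounded_pos)
  have "compact (g ` L)"
    using compact_continuous_image[OF continuous_on_subset[OF cont] L] by simp
  then obtain G where G: "G > 0" "\<And>x. x \<in> L \<Longrightarrow> norm (g x) \<le> G"
    using compact_imp_bounded bounded_pos by (metis imageI)
  have "uniformly_continuous_on (cball 0 (R + 1)) g"
    by (intro compact_uniformly_continuous continuous_on_subset[OF cont]) auto
  then obtain \<delta> where \<delta>: "\<delta> > 0"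
    "\<And>x y. x \<in> cball 0 (R + 1) \<Longrightarrow> y \<in> cball 0 (R + 1) \<Longrightarrow> dist y x < \<delta> \<Longrightarrow> dist (g y) (g x) < \<epsilon>"
    using \<open>\<epsilon> > 0\<close> unfolding uniformly_continuous_on_def by metis
  \<comment> \<open>Dividing by \<open>G\<close> bounds the step length by
    \<open>min 1 (\<delta> / 2)\<close>: the 1 keeps the segment in the ball of radius
    \<open>R + 1\<close>, and the half makes the distance strictly less than
    \<open>\<delta>\<close>.\<close>
  define s where "s = min 1 (\<delta> / 2) / G"
  have "s > 0" using G \<delta> by (simp add: s_def)
  moreover have "f (x - t *\<^sub>R g x) \<le> f x - t * norm (g x) * (norm (g x) - \<epsilon>)"
    if x: "x \<in> L" and t: "0 < t" "t \<le> s" for x t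
  proof -
    have tg: "t * norm (g x) \<le> min 1 (\<delta> / 2)"
    proof -
      have "t * norm (g x) \<le> s * G"
        using t G(2)[OF x] by (intro mult_mono) auto
      then show ?thesis using G(1) by (simp add: s_def)
    qed
    define p where "p \<tau> = x - (\<tau> * t) *\<^sub>R g x" for \<tau>
    have "((\<lambda>\<tau>. f (p \<tau>)) has_derivative (\<lambda>h. g (p \<tau>) \<bullet> (- (h * t) *\<^sub>R g x)))
      (at \<tau> within {0..1})" for \<tau>
    proof -
      have "(p has_derivative (\<lambda>h. - (h * t) *\<^sub>R g x)) (at \<tau> within {0..1})"
        unfolding p_def by (auto intro!: derivative_eq_intros)
      from has_derivative_compose[OF this deriv] show ?thesis .
    qed
    then obtain \<tau> where \<tau>: "\<tau> \<in> {0<..<1}"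
      "f (p 1) - f (p 0) = g (p \<tau>) \<bullet> (- ((1 - 0) * t) *\<^sub>R g x)"
      using mvt_simple[of 0 1 "\<lambda>\<tau>. f (p \<tau>)" "\<lambda>\<tau> h. g (p \<tau>) \<bullet> (- (h * t) *\<^sub>R g x)"] by auto
    have dist: "dist (p \<tau>) x \<le> t * norm (g x)"
      using \<tau>(1) t by (simp add: p_def dist_norm mult_left_le_one_le mult_right_mono)
    have "norm (p \<tau>) \<le> norm x + dist (p \<tau>) x"
      by (metis dist_norm norm_triangle_sub)
    then have "dist (g (p \<tau>)) (g x) < \<epsilon>"
      using dist tg R(2)[OF x] \<delta> by (intro \<delta>(2)) auto
    then have "(g x - g (p \<tau>)) \<bullet> g x \<le> \<epsilon> * norm (g x)"
      by (smt (verit) dist_norm dist_commute mult_right_mono norm_cauchy_schwarz norm_ge_zero)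
    then have "norm (g x) * (norm (g x) - \<epsilon>) \<le> g (p \<tau>) \<bullet> g x"
      by (simp add: inner_diff_left algebra_simps flip: power2_norm_eq_inner power2_eq_square)
    then have "t * (norm (g x) * (norm (g x) - \<epsilon>)) \<le> t * (g (p \<tau>) \<bullet> g x)"
      using t by simp
    then show ?thesis using \<tau>(2) by (simp add: p_def mult.assoc)
  qed
  ultimately show thesis by (rule that)
qed

section \<open>Existence and connectedness of the set of minimisers\<close>

lemma coercive_attains_min:
  fixes f :: "'a::euclidean_space \<Rightarrow> real"
  assumes cont: "continuous_on UNIV f"
    and coercive: "\<And>x. bounded {z. f z \<le> f x}"
  obtains x where "\<And>y. f x \<le> f y"
proof -
  have "closed {z. f z \<le> f 0}"
    using cont by (intro closed_Collect_le) auto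
  then have "compact {z. f z \<le> f 0}"
    using coercive by (simp add: compact_eq_bounded_closed)
  moreover have "{z. f z \<le> f 0} \<noteq> {}" by blast
  ultimately obtain x where "f x \<le> f 0" "\<And>y. f y \<le> f 0 \<Longrightarrow> f x \<le> f y"
    using continuous_attains_inf[OF _ _ continuous_on_subset[OF cont subset_UNIV]]
    by (metis mem_Collect_eq)
  then show thesis by (intro that[of x]) (metis linorder_le_cases order_trans)
qed

text \<open>One step size \<open>t\<close> serves two ends, separated by a level \<open>b\<close>
  between the minimum and \<open>c\<close>. From above \<open>b\<close> each step lowers
  \<open>f\<close> by a fixed amount \<open>r\<close>; from below \<open>b\<close>, where the
  gradient may be small and a step may raise \<open>f\<close>, the rise stays within the margin
  \<open>c - b\<close>.\<close>

lemma connected_between_minimisers_and_sublevel: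
  fixes f :: "'a::euclidean_space \<Rightarrow> real"
  assumes deriv: "\<And>x. (f has_derivative (\<lambda>h. g x \<bullet> h)) (at x)"
    and cont: "continuous_on UNIV g"
    and coercive: "\<And>x. bounded {z. f z \<le> f x}"
    and critical: "\<And>x y. g x = 0 \<Longrightarrow> f x \<le> f y"
    and x0: "\<And>y. f x0 \<le> f y" and c: "f x0 < c"
  obtains S where "connected S" "{x. f x = f x0} \<subseteq> S" "S \<subseteq> {x. f x \<le> c}"
proof -
  have contf: "continuous_on A f" for A
    using deriv has_derivative_continuous continuous_at_imp_continuous_on by blast
  have g0: "g x = 0" if "f x = f x0" for x
  proof -
    have "(\<lambda>h. g x \<bullet> h) = (\<lambda>h. 0)"
      using that x0 by (intro differential_zero_maxmin[OF _ open_UNIV deriv]) auto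
    then show ?thesis by (metis inner_eq_zero_iff)
  qed
  have "bounded {x. f x = f x0}"
    by (rule bounded_subset[OF coercive[of x0]]) auto
  then obtain R where R: "R > 0" "{x. f x = f x0} \<subseteq> cball 0 R"
    using bounded_pos[THEN iffD1] by (metis mem_cball_0 subsetI)
  obtain x1 where x1: "\<And>x. x \<in> cball 0 R \<Longrightarrow> f x \<le> f x1"
    using continuous_attains_sup[of "cball 0 R" f] contf R(1) by (metis compact_cball cball_eq_empty not_less_iff_gr_or_eq)
  define C where "C = f x1"
  define L where "L = {x. f x \<le> C}"
  have "closed L"
    unfolding L_def using contf by (intro closed_Collect_le) auto
  then have L: "compact L"
    using coercive[of x1] by (simp add: compact_eq_bounded_closed L_def C_def)
  define b where "b = (f x0 + c) / 2"
  have b: "f x0 < b" "b < c" using c by (auto simp: b_def)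
  define E where "E = L \<inter> {x. b \<le> f x}"
  have "compact E"
    unfolding E_def using contf by (intro compact_Int_closed[OF L] closed_Collect_le) auto
  \<comment> \<open>\<open>E\<close> is compact and contains no critical point, since those lie at
    the level \<open>f x0 < b\<close>; hence the gradient norm has a positive minimum on it. If
    \<open>E\<close> is empty, 1 is an arbitrary choice.\<close>
  obtain \<delta> where \<delta>: "\<delta> > 0" "\<And>x. x \<in> E \<Longrightarrow> \<delta> \<le> norm (g x)"
  proof (cases "E = {}")
    case False
    have "continuous_on E (\<lambda>x. norm (g x))"
      by (intro continuous_intros continuous_on_subset[OF cont]) auto
    then obtain z where z: "z \<in> E" "\<And>x. x \<in> E \<Longrightarrow> norm (g z) \<le> norm (g x)"
      using continuous_attains_inf[OF \<open>compact E\<close> False] by blast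
    have "g z \<noteq> 0"
      using critical[of z x0] b z(1) by (auto simp: E_def)
    then show thesis using z(2) by (intro that[of "norm (g z)"]) auto
  qed (auto intro: that[of 1])
  obtain s where s: "s > 0"
    "\<And>x t. x \<in> L \<Longrightarrow> 0 < t \<Longrightarrow> t \<le> s \<Longrightarrow>
       f (x - t *\<^sub>R g x) \<le> f x - t * norm (g x) * (norm (g x) - \<delta> / 2)"
    using gradient_step_estimate[OF deriv cont L, of "\<delta> / 2"] \<delta>(1) by (metis half_gt_zero)
  have "compact (g ` L)"
    using compact_continuous_image[OF continuous_on_subset[OF cont] L] by simp
  then obtain G where G: "G > 0" "\<And>x. x \<in> L \<Longrightarrow> norm (g x) \<le> G"
    using compact_imp_bounded bounded_pos by (metis imageI)
  \<comment> \<open>The bound \<open>s\<close> makes the estimate with tolerance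
    \<open>\<delta> / 2\<close> applicable; the other one limits the rise of \<open>f\<close> from
    below \<open>b\<close> to \<open>t * G * \<delta> \<le> c - b\<close>.\<close>
  define t where "t = min s ((c - b) / (G * \<delta>))"
  have t: "0 < t" "t \<le> s" using s G \<delta> b by (auto simp: t_def)
  have tGd: "t * G * \<delta> \<le> c - b"
  proof -
    have "t \<le> (c - b) / (G * \<delta>)" by (simp add: t_def)
    then show ?thesis using G \<delta> by (simp add: pos_le_divide_eq mult.assoc)
  qed
  define T where "T x = x - t *\<^sub>R g x" for x
  define r where "r = t * \<delta> * (\<delta> / 2)"
  have r: "r > 0" using t \<delta> by (simp add: r_def)
  have step_high: "f (T x) \<le> f x - r" if "x \<in> L" "b \<le> f x" for x
  proof -
    have "\<delta> \<le> norm (g x)" using that \<delta> by (simp add: E_def)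
    then have "\<delta> * (\<delta> / 2) \<le> norm (g x) * (norm (g x) - \<delta> / 2)"
      using \<delta>(1) by (intro mult_mono) auto
    then have "r \<le> t * (norm (g x) * (norm (g x) - \<delta> / 2))"
      unfolding r_def mult.assoc using t by (intro mult_left_mono) auto
    then show ?thesis using s(2)[OF that(1) t] by (simp add: T_def mult.assoc)
  qed
  have step_low: "f (T x) \<le> c" if "x \<in> L" "f x \<le> b" for x
  proof -
    have "norm (g x) * (\<delta> / 2 - norm (g x)) \<le> norm (g x) * \<delta>"
      using \<delta>(1) norm_ge_zero[of "g x"] by (intro mult_left_mono) linarith+
    also have "\<dots> \<le> G * \<delta>"
      using \<delta>(1) G(2)[OF that(1)] by simp
    finally have "norm (g x) * (\<delta> / 2 - norm (g x)) \<le> G * \<delta>" .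
    then have "t * (norm (g x) * (\<delta> / 2 - norm (g x))) \<le> t * (G * \<delta>)"
      using t by (intro mult_left_mono) auto
    moreover have "t * norm (g x) * (norm (g x) - \<delta> / 2)
        = - (t * (norm (g x) * (\<delta> / 2 - norm (g x))))"
      by (simp add: algebra_simps)
    moreover have "f (T x) \<le> f x - t * norm (g x) * (norm (g x) - \<delta> / 2)"
      unfolding T_def by (rule s(2)[OF that(1) t])
    moreover have "t * (G * \<delta>) \<le> c - b" using tGd by (simp add: mult.assoc)
    ultimately show ?thesis using that(2) by linarith
  qed
  \<comment> \<open>Since \<open>c \<le> C\<close>, the bound never exceeds \<open>C\<close>, so the
    iterates stay in \<open>L\<close>, where both step estimates hold. A step from above
    \<open>b\<close> gains \<open>r\<close>; any other step ends at level at most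
    \<open>c\<close>.\<close>
  have iter: "f ((T ^^ n) x) \<le> max c (C - n * r)" if "f x \<le> C" "c \<le> C" for n x
  proof (induction n)
    case (Suc n)
    let ?y = "(T ^^ n) x"
    have "max c (C - n * r) \<le> C" using that r by simp
    then have "?y \<in> L" using order_trans[OF Suc] by (simp add: L_def)
    then show ?case
      using Suc step_high[of ?y] step_low[of ?y] r by (cases "b \<le> f ?y") (auto simp: algebra_simps)
  qed (use that in auto)
  show thesis
  proof (cases "c \<le> C")
    \<comment> \<open>Here the whole ball already lies below level \<open>c\<close>, so no iteration
      is required.\<close>
    case False
    show thesis
    proof (rule that)
      show "cball 0 R \<subseteq> {x. f x \<le> c}"
        using x1 False by (force simp: C_def)
    qed (use R in auto)
  next
    case True
    obtain n :: nat where "(C - c) / r < n"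
      using reals_Archimedean2 by blast
    then have n: "C - n * r \<le> c" using r by (simp add: field_simps)
    have contT: "continuous_on UNIV (T ^^ k)" for k
    proof (induction k)
      case (Suc k)
      have "continuous_on UNIV T"
        unfolding T_def by (intro continuous_intros cont)
      then show ?case
        using continuous_on_compose[OF Suc] continuous_on_subset by (metis funpow.simps(2) subset_UNIV)
    qed (simp add: id_def)
    have fixed: "(T ^^ k) x = x" if "f x = f x0" for k x
      by (induction k) (simp_all add: T_def g0[OF that])
    show thesis
    proof (rule that)
      show "connected ((T ^^ n) ` cball 0 R)"
        by (rule connected_continuous_image[OF continuous_on_subset[OF contT]]) auto
      show "{x. f x = f x0} \<subseteq> (T ^^ n) ` cball 0 R"
      proof
        fix x assume "x \<in> {x. f x = f x0}"
        then show "x \<in> (T ^^ n) ` cball 0 R"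
          using R(2) by (intro image_eqI[of _ _ x]) (simp add: fixed, blast)
      qed
      show "(T ^^ n) ` cball 0 R \<subseteq> {x. f x \<le> c}"
      proof
        fix y assume "y \<in> (T ^^ n) ` cball 0 R"
        then obtain x where "x \<in> cball 0 R" "y = (T ^^ n) x" by blast
        moreover have "max c (C - n * r) = c" using n by simp
        ultimately show "y \<in> {x. f x \<le> c}"
          using iter[OF _ True, of x n] x1[of x] by (simp add: C_def)
      qed
    qed
  qed
qed

text \<open>Two closed pieces of the set of minimisers have disjoint open neighbourhoods, and by
  compactness their union contains a sublevel set slightly above the minimum. The connected set of
  the preceding lemma would lie in this union and meet both pieces.\<close>

lemma connected_minimisers:
  fixes f :: "'a::euclidean_space \<Rightarrow> real"
  assumes deriv: "\<And>x. (f has_derivative (\<lambda>h. g x \<bullet> h)) (at x)"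
    and cont: "continuous_on UNIV g"
    and coercive: "\<And>x. bounded {z. f z \<le> f x}"
    and critical: "\<And>x y. g x = 0 \<Longrightarrow> f x \<le> f y"
  shows "connected {x. \<forall>y. f x \<le> f y}"
proof -
  have contf: "continuous_on A f" for A
    using deriv has_derivative_continuous continuous_at_imp_continuous_on by blast
  obtain x0 where x0: "\<And>y. f x0 \<le> f y"
    using coercive_attains_min[OF contf coercive] by blast
  define M where "M = {x. f x = f x0}"
  have M_eq: "{x. \<forall>y. f x \<le> f y} = M"
    unfolding M_def using x0 by (auto intro: antisym order_trans)
  have "closed M"
    unfolding M_def using contf by (intro closed_Collect_eq) auto
  have "connected M"
  proof (rule ccontr)
    assume "\<not> connected M"
    then obtain A B where AB: "closed A" "closed B" "A \<noteq> {}" "B \<noteq> {}" "A \<union> B = M" "A \<inter> B = {}"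
      using connected_closed_set[OF \<open>closed M\<close>] by metis
    obtain U V where UV: "open U" "open V" "A \<subseteq> U" "B \<subseteq> V" "U \<inter> V = {}"
      using separation_normal[OF AB(1,2,6)] by metis
    obtain c where c: "f x0 < c" "{x. f x \<le> c} \<subseteq> U \<union> V"
    proof -
      have "closed {z. f z \<le> f x}" for x
        using contf by (intro closed_Collect_le) auto
      then have compact: "compact {z. f z \<le> f x}" for x
        using coercive by (simp add: compact_eq_bounded_closed)
      show thesis
      proof (cases "U \<union> V = UNIV")
        case True
        then show thesis by (intro that[of "f x0 + 1"]) auto
      next
        case False
        then obtain w where w: "w \<notin> U \<union> V" by blast
        \<comment> \<open>The minimum of \<open>f\<close> over \<open>D\<close> is attained outside
          \<open>M\<close>, hence exceeds \<open>f x0\<close>. Points strictly below it lie in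
          \<open>U \<union> V\<close>, so the midpoint of the two values is a suitable
          \<open>c\<close>.\<close>
        define D where "D = {z. f z \<le> f w} \<inter> - (U \<union> V)"
        have "compact D"
          unfolding D_def using UV by (intro compact_Int_closed compact) auto
        moreover have "D \<noteq> {}" using w by (auto simp: D_def)
        ultimately obtain d where d: "d \<in> D" "\<And>z. z \<in> D \<Longrightarrow> f d \<le> f z"
          using continuous_attains_inf[OF _ _ contf] by metis
        have "d \<notin> M" using d(1) UV AB(5) by (auto simp: D_def)
        then have "f x0 < f d" using x0[of d] by (simp add: M_def)
        moreover have "z \<in> U \<union> V" if "f z < f d" for z
        proof -
          have "f z \<le> f w" using d(1) that by (simp add: D_def)
          moreover have "z \<notin> D" using d(2)[of z] that by linarith
          ultimately show ?thesis by (auto simp: D_def)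
        qed
        ultimately show thesis
          by (intro that[of "(f x0 + f d) / 2"] subsetI) auto
      qed
    qed
    obtain S where S: "connected S" "M \<subseteq> S" "S \<subseteq> {x. f x \<le> c}"
      using connected_between_minimisers_and_sublevel[OF deriv cont coercive critical x0 c(1)]
      unfolding M_def by metis
    have "S \<subseteq> U \<union> V" using S(3) c(2) by blast
    then have "U \<inter> S = {} \<or> V \<inter> S = {}"
      using connectedD[OF S(1) UV(1,2)] UV(5) by blast
    then show False using AB S(2) UV by blast
  qed
  then show ?thesis by (simp add: M_eq)
qed

section \<open>Unilateral deviations and partial derivatives\<close>

lemma deviate_self [simp]: "deviate owner i a a = a"
  by (simp add: deviate_def vec_eq_iff)

lemma deviate_action_of [simp]: "deviate owner i (action_of owner i x) a = deviate owner i x a"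
  by (simp add: deviate_def action_of_def vec_eq_iff)

lemma action_of_in_actions [simp]: "action_of owner i a \<in> actions owner i"
  by (simp add: action_of_def actions_def)

lemma sum_action_of: "(\<Sum>i\<in>UNIV. action_of owner i h) = h"
  by (simp add: action_of_def vec_eq_iff)

text \<open>Deviations may range over all vectors instead of the subspace
  \<open>actions owner i\<close>, because \<open>deviate\<close> reads only the coordinates of
  player \<open>i\<close> in \<open>x\<close>.\<close>

lemma nash_equilibrium_iff:
  "nash_equilibrium owner u a \<longleftrightarrow> (\<forall>i x. u i (deviate owner i x a) \<le> u i a)"
proof -
  have "(\<forall>y\<in>actions owner i. u i (deviate owner i y a) \<le> u i a) \<longleftrightarrow>
      (\<forall>x. u i (deviate owner i x a) \<le> u i a)" for i
    by (metis action_of_in_actions deviate_action_of)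
  then show ?thesis
    by (simp add: nash_equilibrium_def best_response_def is_arg_max_linorder Ball_def)
qed

lemma has_derivative_deviate:
  "((\<lambda>x. deviate owner i x a) has_derivative action_of owner i) (at x)"
proof -
  \<comment> \<open>The map is affine in \<open>x\<close>, with linear part
    \<open>action_of owner i\<close>.\<close>
  have "(\<lambda>x. deviate owner i x a) = (\<lambda>x. action_of owner i x + deviate owner i 0 a)"
    by (simp add: deviate_def action_of_def vec_eq_iff fun_eq_iff)
  moreover have "bounded_linear (action_of owner i)"
    by (intro linear_conv_bounded_linear[THEN iffD1] linearI)
      (simp_all add: action_of_def vec_eq_iff)
  then have "((\<lambda>x. action_of owner i x + deviate owner i 0 a) has_derivative action_of owner i) (at x)"
    by (intro has_derivative_add_const bounded_linear_imp_has_derivative)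
  ultimately show ?thesis by simp
qed

lemma has_derivative_compose_deviate:
  assumes "\<And>x. (f has_derivative f' x) (at x)"
  shows "((\<lambda>x. f (deviate owner i x a)) has_derivative
    (\<lambda>h. f' (deviate owner i x a) (action_of owner i h))) (at x)"
  by (rule has_derivative_compose[OF has_derivative_deviate assms])

lemma partial_derivative_eq:
  assumes "\<And>x. (f has_derivative f' x) (at x)"
  shows "partial_derivative owner i f a = (\<lambda>h. f' a (action_of owner i h))"
proof -
  have "((\<lambda>x. f (deviate owner i x a)) has_derivative (\<lambda>h. f' a (action_of owner i h))) (at a)"
    using has_derivative_compose_deviate[OF assms, of owner i a a] by simp
  then show ?thesis
    unfolding partial_derivative_def by (rule frechet_derivative_at[symmetric])
qed

text \<open>For fixed \<open>a\<close>, the difference of \<open>v\<close> and \<open>P\<close> at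
  \<open>deviate owner i x a\<close> has zero derivative in \<open>x\<close>, since the partial
  derivatives agree at every such profile. It is therefore constant; the values at \<open>x\<close>
  and at \<open>a\<close> are compared.\<close>

lemma utility_minus_potential:
  assumes "continuously_differentiable v" "continuously_differentiable P"
    and "\<And>a. partial_derivative owner i P a = partial_derivative owner i v a"
  shows "v (deviate owner i x a) - v a = P (deviate owner i x a) - P a"
proof -
  obtain v' where v': "\<And>x. (v has_derivative blinfun_apply (v' x)) (at x)"
    using assms(1) unfolding continuously_differentiable_def by blast
  obtain P' where P': "\<And>x. (P has_derivative blinfun_apply (P' x)) (at x)"
    using assms(2) unfolding continuously_differentiable_def by blast
  have eq: "blinfun_apply (v' b) (action_of owner i h) = blinfun_apply (P' b) (action_of owner i h)" for b h
    using assms(3)[of b] unfolding partial_derivative_eq[OF v'] partial_derivative_eq[OF P']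
    by (rule fun_cong[OF sym])
  have "((\<lambda>x. v (deviate owner i x a) - P (deviate owner i x a)) has_derivative (\<lambda>h. 0))
      (at x within UNIV)" for x
    using has_derivative_diff[OF has_derivative_compose_deviate[OF v', of owner i a x]
        has_derivative_compose_deviate[OF P', of owner i a x]]
    by (simp add: eq)
  from has_derivative_zero_constant[OF convex_UNIV this]
  obtain k where "\<And>x. v (deviate owner i x a) - P (deviate owner i x a) = k" by auto
  from this[of x] this[of a] show ?thesis by simp
qed

theorem proposition4:
  fixes owner :: "'k::finite \<Rightarrow> 'n::finite"
    and u :: "'n \<Rightarrow> real ^ 'k \<Rightarrow> real"
    and P :: "real ^ 'k \<Rightarrow> real"
  assumes "incave_potential_game owner u P"
  shows "(\<exists>a. nash_equilibrium owner u a) \<and> connected {a. nash_equilibrium owner u a}"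
proof -
  have cu: "continuously_differentiable (u i)" and cP: "continuously_differentiable P"
    and pd: "partial_derivative owner i P a = partial_derivative owner i (u i) a"
    and inc: "invex (\<lambda>x. - P x)" and dec: "decreasing_at_infinity P" for i a
    using assms by (auto simp: incave_potential_game_def incave_def)
  obtain G where G: "\<And>x. (P has_derivative (\<lambda>h. G x \<bullet> h)) (at x)" and cG: "continuous_on UNIV G"
    using continuously_differentiable_gradient[OF cP] by metis
  define f where "f x = - P x" for x
  define g where "g x = - G x" for x
  have deriv: "(f has_derivative (\<lambda>h. g x \<bullet> h)) (at x)" for x
    using has_derivative_minus[OF G[of x]] by (simp add: f_def[abs_def] g_def)
  have cont: "continuous_on UNIV g"
    unfolding g_def by (intro continuous_intros cG)
  have coercive: "bounded {z. f z \<le> f x}" for x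
  proof -
    obtain K where "compact K" "\<And>z. z \<notin> K \<Longrightarrow> P z < P x"
      using dec unfolding decreasing_at_infinity_def by blast
    then show ?thesis
      by (intro bounded_subset[OF compact_imp_bounded[of K]]) (force simp: f_def)+
  qed
  have critical: "f x \<le> f y" if "g x = 0" for x y
    using inc deriv[of x] that by (simp add: invex_def f_def[abs_def])
  \<comment> \<open>A deviation changes utility and potential by the same amount, so
    \<open>P\<close> can stand in for every \<open>u i\<close>.\<close>
  have nash: "nash_equilibrium owner u a \<longleftrightarrow> (\<forall>i x. P (deviate owner i x a) \<le> P a)" for a
    unfolding nash_equilibrium_iff using utility_minus_potential[OF cu cP pd]
    by (metis diff_le_0_iff_le)
  have nash_iff: "nash_equilibrium owner u a \<longleftrightarrow> (\<forall>y. f a \<le> f y)" for a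
  proof
    assume "nash_equilibrium owner u a"
    then have le: "P (deviate owner i x a) \<le> P a" for i x by (simp add: nash)
    have zero: "G a \<bullet> action_of owner i h = 0" for i h
    proof -
      \<comment> \<open>By \<open>le\<close>, the function
        \<open>\<lambda>x. P (deviate owner i x a)\<close> is maximal at \<open>x = a\<close>, so
        its derivative vanishes there.\<close>
      have "(\<lambda>h. G a \<bullet> action_of owner i h) = (\<lambda>h. 0)"
        using le has_derivative_compose_deviate[OF G, of owner i a a]
        by (intro differential_zero_maxmin[of a UNIV "\<lambda>x. P (deviate owner i x a)"]) auto
      then show ?thesis by meson
    qed
    \<comment> \<open>The components of the players add up to the full vector, so vanishing on each
      block forces the squared norm of the gradient to be 0.\<close>
    have "G a \<bullet> G a = (\<Sum>i\<in>UNIV. G a \<bullet> action_of owner i (G a))"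
      by (simp add: sum_action_of flip: inner_sum_right)
    then have "G a = 0" by (simp add: zero)
    then show "\<forall>y. f a \<le> f y" using critical by (simp add: g_def)
  qed (simp add: nash f_def)
  have "continuous_on UNIV f"
    using deriv has_derivative_continuous continuous_at_imp_continuous_on by blast
  then obtain a where "\<And>y. f a \<le> f y"
    using coercive_attains_min[OF _ coercive] by blast
  then show ?thesis
    unfolding nash_iff using connected_minimisers[OF deriv cont coercive critical] by blast
qed

end
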